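(* Let $\Omega$ be a compact topological space. Let $\{T_\omega\}_{\omega\in\Omega}$ be a family of contractive $C_0$-semigroups on a Banach space $\mathcal{E}$, and let $A_\omega$ and $V_\omega$ denote the generator and the co-generator of $T_\omega$, respectively, for each $\omega\in\Omega$. Then the following are equivalent: (a) $\{T_\omega\}_{\omega\in\Omega}$ is $k_{\mathrm{SOT}}$-continuous in the index set; (b) the map $\Omega\ni\omega\mapsto R(\lambda,A_\omega)\in\mathcal{L}(\mathcal{E})$ is strongly continuous, uniformly for $\lambda$ on compact subsets of the open right half-plane $\{z\in\mathbb{C}:\operatorname{Re} z>0\}$; (c) the map $\Omega\ni\omega\mapsto R(1,A_\omega)\in\mathcal{L}(\mathcal{E})$ is strongly continuous; (d) the map $\Omega\ni\omega\mapsto V_\omega\in\mathbf{C}(\mathcal{E})$ is strongly continuous.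
   Context: $\mathcal{L}(\mathcal{E})$ denotes the bounded linear operators on $\mathcal{E}$ and $\mathbf{C}(\mathcal{E})\subseteq\mathcal{L}(\mathcal{E})$ denotes the set of contractions on $\mathcal{E}$. $R(\lambda,A)=(\lambda\mathbf{1}-A)^{-1}$ is the resolvent. The co-generator of a contractive $C_0$-semigroup with generator $A$ is $V=(A+\mathbf{1})(A-\mathbf{1})^{-1}=\mathbf{1}-2R(1,A)$. The family $\{T_\omega\}_{\omega\in\Omega}$ is $k_{\mathrm{SOT}}$-continuous in the index set if for every $\omega_0\in\Omega$, every compact $K\subseteq\mathbb{R}_{\ge 0}$ and every $\xi\in\mathcal{E}$ one has $\sup_{t\in K}\|(T_\omega(t)-T_{\omega_0}(t))\xi\|\to 0$ as $\omega\to\omega_0$. Condition (b) means: for every $\omega_0\in\Omega$, every compact $L\subseteq\{z:\operatorname{Re} z>0\}$ and every $\xi\in\mathcal{E}$, $\sup_{\lambda\in L}\|(R(\lambda,A_\omega)-R(\lambda,A_{\omega_0}))\xi\|\to 0$ as $\omega\to\omega_0$.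
   Formalization: In (d), the co-generators are taken in the bounded operators L(E) rather than the contractions C(E), because on a general Banach space V_ω need not be a contraction (for translations on C_0(R) its norm is 3). *)

theory Defs
  imports "HOL-Analysis.Analysis"
begin

text \<open>
  Complex Banach spaces: a Banach space whose real scalar multiplication is the restriction
  of a complex one with homogeneous norm.
\<close>

class complex_banach = banach +
  fixes scaleC :: "complex \<Rightarrow> 'a \<Rightarrow> 'a"  (infixr "*\<^sub>C" 75)
  assumes scaleC_add_right: "a *\<^sub>C (x + y) = a *\<^sub>C x + a *\<^sub>C y"
    and scaleC_add_left: "(a + b) *\<^sub>C x = a *\<^sub>C x + b *\<^sub>C x"
    and scaleC_scaleC: "a *\<^sub>C b *\<^sub>C x = (a * b) *\<^sub>C x"
    and scaleC_of_real: "complex_of_real r *\<^sub>C x = r *\<^sub>R x"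
    and norm_scaleC: "norm (a *\<^sub>C x) = cmod a * norm x"

instantiation complex :: complex_banach
begin

definition scaleC_complex_def: "a *\<^sub>C (x :: complex) = a * x"

instance
  by standard (auto simp: scaleC_complex_def algebra_simps norm_mult scaleR_conv_of_real)

end

text \<open>
  The library type of bounded operators only asks for real linearity, so complex linearity of
  the operators \<open>T t\<close> is required separately; it is inherited by the generator and by
  everything built from it. Only the values \<open>T t\<close> for \<open>t \<ge> 0\<close> matter.
\<close>

definition contractive_C0_semigroup :: "(real \<Rightarrow> 'a::complex_banach \<Rightarrow>\<^sub>L 'a) \<Rightarrow> bool" where
  "contractive_C0_semigroup T \<longleftrightarrow>
     (\<forall>t\<ge>0. \<forall>c x. T t (c *\<^sub>C x) = c *\<^sub>C T t x) \<and>
     T 0 = id_blinfun \<and>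
     (\<forall>s\<ge>0. \<forall>t\<ge>0. T (s + t) = T s o\<^sub>L T t) \<and>
     (\<forall>x. continuous_on {0..} (\<lambda>t. T t x)) \<and>
     (\<forall>t\<ge>0. norm (T t) \<le> 1)"

text \<open>
  Unbounded operators are represented by their graphs. In particular, the domain of the
  generator consists of those \<open>x\<close> for which the difference quotients converge.
\<close>

definition generator :: "(real \<Rightarrow> 'a::complex_banach \<Rightarrow>\<^sub>L 'a) \<Rightarrow> ('a \<times> 'a) set" where
  "generator T = {(x, y). ((\<lambda>t. (1 / t) *\<^sub>R (T t x - x)) \<longlongrightarrow> y) (at_right 0)}"

text \<open>
  The bounded operator, defined on the whole space, with a given graph (unspecified if there
  is none; it is unique if it exists).
\<close>

definition blinfun_of_graph :: "('a \<times> 'a) set \<Rightarrow> 'a::complex_banach \<Rightarrow>\<^sub>L 'a" where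
  "blinfun_of_graph G = (THE B. G = {(x, blinfun_apply B x) | x. True})"

text \<open>
  The graph of \<open>(\<lambda>1 - A)\<inverse>\<close>, and that of \<open>(A + 1)(A - 1)\<inverse>\<close>, which maps \<open>A x - x\<close> to
  \<open>A x + x\<close> for every \<open>x\<close> in the domain of \<open>A\<close>.
\<close>

definition resolvent :: "complex \<Rightarrow> ('a \<times> 'a) set \<Rightarrow> 'a::complex_banach \<Rightarrow>\<^sub>L 'a" where
  "resolvent l A = blinfun_of_graph {(l *\<^sub>C x - y, x) | x y. (x, y) \<in> A}"

definition cogenerator :: "(real \<Rightarrow> 'a::complex_banach \<Rightarrow>\<^sub>L 'a) \<Rightarrow> 'a \<Rightarrow>\<^sub>L 'a" where
  "cogenerator T = blinfun_of_graph {(y - x, y + x) | x y. (x, y) \<in> generator T}"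

text \<open>
  Suprema are taken in the extended nonnegative reals, where the supremum over the empty set
  is \<open>0\<close>.
\<close>

definition k_SOT_continuous ::
    "'w topology \<Rightarrow> ('w \<Rightarrow> real \<Rightarrow> 'a::complex_banach \<Rightarrow>\<^sub>L 'a) \<Rightarrow> bool" where
  "k_SOT_continuous X T \<longleftrightarrow>
     (\<forall>w0\<in>topspace X. \<forall>K. compact K \<and> K \<subseteq> {0..} \<longrightarrow>
        (\<forall>x. ((\<lambda>w. SUP t\<in>K. ennreal (norm ((T w t - T w0 t) x))) \<longlongrightarrow> 0) (nhdsin X w0)))"

definition resolvents_strongly_continuous_locally_uniformly ::
    "'w topology \<Rightarrow> ('w \<Rightarrow> ('a \<times> 'a::complex_banach) set) \<Rightarrow> bool" where
  "resolvents_strongly_continuous_locally_uniformly X A \<longleftrightarrow>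
     (\<forall>w0\<in>topspace X. \<forall>L. compact L \<and> L \<subseteq> {z. 0 < Re z} \<longrightarrow>
        (\<forall>x. ((\<lambda>w. SUP l\<in>L. ennreal (norm ((resolvent l (A w) - resolvent l (A w0)) x)))
                \<longlongrightarrow> 0) (nhdsin X w0)))"

end

theory Submission
  imports Defs
begin

text \<open>
  The four conditions are linked by (a) to (b) to (c) to (a), together with (c) equivalent to (d).

  The resolvent at \<open>l\<close> is the Laplace transform of the semigroup. Up to a finite time \<open>s\<close> this
  reads \<open>R(l) z = \<integral>\<^sub>0\<^sup>s e\<^sup>-\<^sup>l\<^sup>u T(u) z du + R(l) e\<^sup>-\<^sup>l\<^sup>s T(s) z\<close> (\<open>resolvent_laplace\<close>). The last
  term is small for large \<open>s\<close>, uniformly as long as \<open>Re l\<close> is bounded away from \<open>0\<close>, and the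
  integral only involves \<open>T\<close> on \<open>[0, s]\<close>. Hence convergence of the semigroups on compact time
  intervals carries over to the resolvents, uniformly on compact parameter sets
  (\<open>uniform_limit_resolvent\<close>); this is (a) to (b), and (c) is the case of the set \<open>{1}\<close>.

  The way back from (c) to (a) is the Trotter-Kato theorem (\<open>trotter_kato\<close>). The semigroups are
  compared along a curve that interpolates between them; multiplied by a resolvent on each side,
  it has the derivative \<open>T\<^sub>w(t - s) (R0 - R\<^sub>w) T0(s) x\<close>, so that the mean value inequality
  (\<open>duhamel_bound\<close>) reduces everything to the convergence of the resolvents on a compact orbit.
  Density of the domain of the generator and contractivity then remove the resolvents.

  Finally \<open>V = 1 - 2 R(1)\<close> (\<open>cogenerator_eq\<close>) makes (c) and (d) equivalent.

  As generators are graphs, it has to be established first that \<open>l - A\<close> is a bijection with bounded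
  inverse for \<open>Re l > 0\<close> (\<open>resolvent_graph\<close>). Injectivity and the bound \<open>1 / Re l\<close> come from
  dissipativity; surjectivity comes from the integral of the rescaled semigroup over a unit interval
  and from Banach's fixed point theorem.
\<close>

section \<open>Bilinearity of scalar multiplication, limits and derivatives\<close>

lemma bounded_bilinear_scaleC:
  "bounded_bilinear (scaleC :: complex \<Rightarrow> 'a::complex_banach \<Rightarrow> 'a)"
proof
  show "(r *\<^sub>R a) *\<^sub>C b = r *\<^sub>R (a *\<^sub>C b)" for r a and b :: 'a
    by (simp add: scaleC_of_real[where 'a = 'a, symmetric] scaleC_scaleC scaleR_conv_of_real)
  show "a *\<^sub>C (r *\<^sub>R b) = r *\<^sub>R (a *\<^sub>C b)" for r a and b :: 'a
    by (simp add: scaleC_of_real[where 'a = 'a, symmetric] scaleC_scaleC mult.commute)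
  show "\<exists>K. \<forall>a (b::'a). norm (a *\<^sub>C b) \<le> norm a * norm b * K"
    by (rule exI[of _ 1]) (simp add: norm_scaleC)
qed (fact scaleC_add_left scaleC_add_right)+

lemmas tendsto_scaleC = bounded_bilinear.tendsto[OF bounded_bilinear_scaleC]
  and continuous_on_scaleC = bounded_bilinear.continuous_on[OF bounded_bilinear_scaleC]
  and scaleC_diff_left = bounded_bilinear.diff_left[OF bounded_bilinear_scaleC]
  and scaleC_diff_right = bounded_bilinear.diff_right[OF bounded_bilinear_scaleC]
  and scaleC_minus_left = bounded_bilinear.minus_left[OF bounded_bilinear_scaleC]
  and scaleC_scaleR_left = bounded_bilinear.scaleR_left[OF bounded_bilinear_scaleC]
  and scaleC_scaleR_right = bounded_bilinear.scaleR_right[OF bounded_bilinear_scaleC]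

lemma scaleC_one [simp]: "1 *\<^sub>C (x::'a::complex_banach) = x"
  using scaleC_of_real[of 1 x] by simp

text \<open>
  Translates the conditions (a) and (b), which are phrased with suprema in \<open>ennreal\<close>, into the
  library notion of uniform convergence, for which the \<open>\<epsilon>\<close>-arguments below are carried out.
\<close>

lemma SUP_norm_diff_tendsto_0_iff_uniform_limit:
  fixes f :: "'w \<Rightarrow> 'b \<Rightarrow> 'a::real_normed_vector"
  shows "((\<lambda>w. SUP t\<in>K. ennreal (norm (f w t - g t))) \<longlongrightarrow> 0) F \<longleftrightarrow> uniform_limit K f g F"
proof
  assume lim: "((\<lambda>w. SUP t\<in>K. ennreal (norm (f w t - g t))) \<longlongrightarrow> 0) F"
  show "uniform_limit K f g F"
    unfolding uniform_limit_iff
  proof (intro allI impI)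
    fix e :: real assume "0 < e"
    then have "\<forall>\<^sub>F w in F. (SUP t\<in>K. ennreal (norm (f w t - g t))) < ennreal e"
      using order_tendstoD(2)[OF lim] by simp
    then show "\<forall>\<^sub>F w in F. \<forall>t\<in>K. dist (f w t) (g t) < e"
    proof eventually_elim
      case (elim w)
      then show ?case
        using \<open>0 < e\<close> by (auto simp: dist_norm ennreal_less_iff dest!: SUP_lessD)
    qed
  qed
next
  assume unif: "uniform_limit K f g F"
  show "((\<lambda>w. SUP t\<in>K. ennreal (norm (f w t - g t))) \<longlongrightarrow> 0) F"
  proof (rule order_tendstoI)
    fix a :: ennreal assume "0 < a"
    then obtain b where b: "0 < b" "b < a"
      using dense by blast
    obtain e where e: "ennreal e = b" "0 < e"
    proof (cases b rule: ennreal_cases)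
      case (real r)
      with b(1) show ?thesis
        by (intro that[of r]) (auto simp: less_le)
    next
      case top
      with b(2) show ?thesis
        by simp
    qed
    have "\<forall>\<^sub>F w in F. \<forall>t\<in>K. dist (f w t) (g t) < e"
      using unif e(2) by (simp add: uniform_limit_iff)
    then show "\<forall>\<^sub>F w in F. (SUP t\<in>K. ennreal (norm (f w t - g t))) < a"
    proof eventually_elim
      case (elim w)
      then have "(SUP t\<in>K. ennreal (norm (f w t - g t))) \<le> ennreal e"
        by (intro SUP_least ennreal_leI) (auto simp: dist_norm less_imp_le)
      then show ?case
        using b(2) e(1) by simp
    qed
  qed simp
qed

text \<open>
  The generator is defined by difference quotients, whereas the mean value inequality and the
  fundamental theorem of calculus speak of \<open>has_vector_derivative\<close>; this mediates between them.
\<close>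

lemma has_vector_derivative_iff_quotient:
  fixes f :: "real \<Rightarrow> 'a::real_normed_vector"
  shows "(f has_vector_derivative D) (at x within S) \<longleftrightarrow>
    ((\<lambda>y. (f y - f x) /\<^sub>R (y - x)) \<longlongrightarrow> D) (at x within S)"
proof -
  have eq: "norm (f y - f x - (y - x) *\<^sub>R D) / norm (y - x)
      = norm ((f y - f x) /\<^sub>R (y - x) - D)" if "y \<noteq> x" for y
  proof -
    have "(f y - f x) /\<^sub>R (y - x) - D = (f y - f x - (y - x) *\<^sub>R D) /\<^sub>R (y - x)"
      using that by (simp add: scaleR_diff_right)
    then show ?thesis
      by (simp add: divide_inverse mult.commute)
  qed
  have "(f has_vector_derivative D) (at x within S) \<longleftrightarrow>
      ((\<lambda>y. norm (f y - f x - (y - x) *\<^sub>R D) / norm (y - x)) \<longlongrightarrow> 0) (at x within S)"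
    unfolding has_vector_derivative_def has_derivative_iff_norm
    by (simp add: bounded_linear_scaleR_left)
  also have "\<dots> \<longleftrightarrow> ((\<lambda>y. norm ((f y - f x) /\<^sub>R (y - x) - D)) \<longlongrightarrow> 0) (at x within S)"
    by (rule tendsto_cong, unfold eventually_at_filter, intro always_eventually allI impI, rule eq)
  also have "\<dots> \<longleftrightarrow> ((\<lambda>y. (f y - f x) /\<^sub>R (y - x)) \<longlongrightarrow> D) (at x within S)"
    by (simp only: tendsto_norm_zero_iff LIM_zero_iff)
  finally show ?thesis .
qed

text \<open>
  Operator multiplication is jointly continuous for the strong topology on norm-bounded sets:
  \<open>U s (v s) - U s x = U s (v s - x)\<close> is small because \<open>U s\<close> is bounded. A strongly
  continuous semigroup is in general not norm continuous, so that this replaces the usual rule for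
  bounded bilinear maps; the same holds for the product rule that follows from it.
\<close>

lemma tendsto_blinfun_apply_strong:
  fixes U :: "'b \<Rightarrow> 'a::real_normed_vector \<Rightarrow>\<^sub>L 'c::real_normed_vector"
  assumes v: "(v \<longlongrightarrow> x) F"
    and U: "((\<lambda>s. U s x) \<longlongrightarrow> y) F"
    and bound: "\<forall>\<^sub>F s in F. norm (U s) \<le> C"
  shows "((\<lambda>s. U s (v s)) \<longlongrightarrow> y) F"
proof -
  have "((\<lambda>s. U s (v s - x)) \<longlongrightarrow> 0) F"
  proof (rule Lim_null_comparison)
    show "\<forall>\<^sub>F s in F. norm (U s (v s - x)) \<le> C * norm (v s - x)"
      using bound
    proof eventually_elim
      case (elim s)
      then show ?case
        by (intro order_trans[OF norm_blinfun] mult_right_mono) auto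
    qed
    show "((\<lambda>s. C * norm (v s - x)) \<longlongrightarrow> 0) F"
      using v by (auto intro!: tendsto_mult_right_zero tendsto_norm_zero LIM_zero)
  qed
  from tendsto_add[OF this U] show ?thesis
    by (simp add: blinfun.diff_right)
qed

lemma has_vector_derivative_blinfun_apply_strong:
  fixes U :: "real \<Rightarrow> 'a::real_normed_vector \<Rightarrow>\<^sub>L 'b::real_normed_vector"
  assumes U': "((\<lambda>s. U s (v s0)) has_vector_derivative a) (at s0)"
    and v': "(v has_vector_derivative b) (at s0)"
    and U: "((\<lambda>s. U s b) \<longlongrightarrow> U s0 b) (at s0)"
    and bound: "\<forall>\<^sub>F s in at s0. norm (U s) \<le> C"
  shows "((\<lambda>s. U s (v s)) has_vector_derivative a + U s0 b) (at s0)"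
proof -
  have "((\<lambda>s. U s ((v s - v s0) /\<^sub>R (s - s0))) \<longlongrightarrow> U s0 b) (at s0)"
    using v' U bound unfolding has_vector_derivative_iff_quotient
    by (rule tendsto_blinfun_apply_strong)
  from tendsto_add[OF U'[unfolded has_vector_derivative_iff_quotient] this]
  show ?thesis
    unfolding has_vector_derivative_iff_quotient
    by (simp add: blinfun.diff_right blinfun.scaleR_right scaleR_diff_right)
qed

text \<open>
  A bounded family of operators is equicontinuous, so strong convergence is already uniform on a
  compact set: control it at the centres of finitely many small balls that cover the set.
\<close>

lemma uniform_limit_blinfun_compact:
  fixes B :: "'w \<Rightarrow> 'a::real_normed_vector \<Rightarrow>\<^sub>L 'b::real_normed_vector"
    and B0 :: "'a \<Rightarrow>\<^sub>L 'b"
  assumes "compact K"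
    and lim: "\<And>x. x \<in> K \<Longrightarrow> ((\<lambda>w. B w x) \<longlongrightarrow> B0 x) F"
    and bound: "\<forall>\<^sub>F w in F. norm (B w - B0) \<le> C"
  shows "uniform_limit K (\<lambda>w. blinfun_apply (B w)) (blinfun_apply B0) F"
  unfolding uniform_limit_iff
proof (intro allI impI)
  fix e :: real assume "0 < e"
  define d where "d = e / (2 * (\<bar>C\<bar> + 1))"
  have "0 < d"
    using \<open>0 < e\<close> by (simp add: d_def)
  obtain N where N: "N \<subseteq> K" "finite N" "K \<subseteq> (\<Union>x\<in>N. ball x d)"
  proof (rule compactE_image[OF \<open>compact K\<close>, of K "\<lambda>x. ball x d"])
    show "K \<subseteq> (\<Union>x\<in>K. ball x d)"
      using \<open>0 < d\<close> by auto
  qed auto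
  have "\<forall>\<^sub>F w in F. \<forall>x\<in>N. dist (B w x) (B0 x) < e / 2"
    using N \<open>0 < e\<close> by (intro eventually_ball_finite ballI tendstoD[OF lim]) auto
  with bound show "\<forall>\<^sub>F w in F. \<forall>y\<in>K. dist (B w y) (B0 y) < e"
  proof eventually_elim
    case (elim w)
    show ?case
    proof
      fix y assume "y \<in> K"
      then obtain x where x: "x \<in> N" "dist x y < d"
        using N by auto
      have "norm ((B w - B0) (y - x)) \<le> C * norm (y - x)"
        using elim(1) by (intro order_trans[OF norm_blinfun] mult_right_mono) auto
      also have "\<dots> \<le> (\<bar>C\<bar> + 1) * d"
        using x by (intro mult_mono) (auto simp: dist_norm norm_minus_commute)
      also have "\<dots> = e / 2"
        by (simp add: d_def field_simps)
      finally have "norm ((B w - B0) (y - x)) \<le> e / 2" .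
      moreover have "norm ((B w - B0) x) < e / 2"
        using elim(2) x by (simp add: dist_norm blinfun.diff_left)
      moreover have "B w y - B0 y = (B w - B0) (y - x) + (B w - B0) x"
        by (simp add: blinfun.diff_left blinfun.diff_right)
      ultimately show "dist (B w y) (B0 y) < e"
        using norm_triangle_ineq[of "(B w - B0) (y - x)" "(B w - B0) x"]
        by (simp add: dist_norm)
    qed
  qed
qed

text \<open>
  The density argument that is used twice in the proof of the Trotter-Kato theorem: for uniformly
  bounded operators, the vectors on which convergence to \<open>0\<close> holds form a closed set.
\<close>

lemma uniform_limit_zero_closure:
  fixes D :: "'w \<Rightarrow> 't \<Rightarrow> 'a::real_normed_vector \<Rightarrow>\<^sub>L 'b::real_normed_vector"
  assumes bound: "\<forall>\<^sub>F w in F. \<forall>t\<in>K. norm (D w t) \<le> C"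
    and lim: "\<And>x. x \<in> S \<Longrightarrow> uniform_limit K (\<lambda>w t. D w t x) (\<lambda>_. 0) F"
    and "z \<in> closure S"
  shows "uniform_limit K (\<lambda>w t. D w t z) (\<lambda>_. 0) F"
  unfolding uniform_limit_iff
proof (intro allI impI)
  fix e :: real assume "0 < e"
  define d where "d = e / (2 * (\<bar>C\<bar> + 1))"
  have "0 < d"
    using \<open>0 < e\<close> by (simp add: d_def)
  then obtain x where x: "x \<in> S" "dist x z < d"
    using \<open>z \<in> closure S\<close> by (auto simp: closure_approachable)
  have "\<forall>\<^sub>F w in F. \<forall>t\<in>K. dist (D w t x) 0 < e / 2"
    using uniform_limitD[OF lim[OF x(1)], of "e / 2"] \<open>0 < e\<close> by simp
  with bound show "\<forall>\<^sub>F w in F. \<forall>t\<in>K. dist (D w t z) 0 < e"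
  proof eventually_elim
    case (elim w)
    show ?case
    proof
      fix t assume "t \<in> K"
      have "norm (D w t (z - x)) \<le> C * norm (z - x)"
        using elim(1) \<open>t \<in> K\<close>
        by (intro order_trans[OF norm_blinfun] mult_right_mono) auto
      also have "\<dots> \<le> (\<bar>C\<bar> + 1) * d"
        using x by (intro mult_mono) (auto simp: dist_norm norm_minus_commute)
      also have "\<dots> = e / 2"
        by (simp add: d_def field_simps)
      finally have "norm (D w t (z - x)) \<le> e / 2" .
      moreover have "norm (D w t x) < e / 2"
        using elim(2) \<open>t \<in> K\<close> by simp
      ultimately show "dist (D w t z) 0 < e"
        using norm_triangle_ineq[of "D w t (z - x)" "D w t x"]
        by (simp add: blinfun.diff_right)
    qed
  qed
qed

lemma continuous_map_euclidean_iff_tendsto_nhdsin: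
  "continuous_map X euclidean f \<longleftrightarrow> (\<forall>w\<in>topspace X. (f \<longlongrightarrow> f w) (nhdsin X w))"
proof -
  have "(f \<longlongrightarrow> f w) (nhdsin X w) \<longleftrightarrow> (f \<longlongrightarrow> f w) (atin X w)" if "w \<in> topspace X" for w
    unfolding tendsto_def eventually_atin eventually_nhdsin using that
    by (metis Diff_iff singletonD singletonI insertE)
  then show ?thesis
    by (simp add: continuous_map_atin)
qed

lemma continuous_map_strong_iff_tendsto_nhdsin:
  "continuous_map X strong_operator_topology B \<longleftrightarrow>
    (\<forall>w\<in>topspace X. \<forall>x. ((\<lambda>w. B w x) \<longlongrightarrow> B w x) (nhdsin X w))"
  unfolding continuous_on_strong_operator_topo_iff_coordinatewise
    continuous_map_euclidean_iff_tendsto_nhdsin by blast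

section \<open>Contraction semigroups, their orbits and their rescalings\<close>

lemma
  assumes "contractive_C0_semigroup T"
  shows C0_semigroup_scaleC: "0 \<le> t \<Longrightarrow> T t (c *\<^sub>C x) = c *\<^sub>C T t x"
    and C0_semigroup_zero: "T 0 = id_blinfun"
    and C0_semigroup_add: "0 \<le> s \<Longrightarrow> 0 \<le> t \<Longrightarrow> T (s + t) x = T s (T t x)"
    and C0_semigroup_continuous_on: "continuous_on {0..} (\<lambda>t. T t x)"
    and C0_semigroup_norm_le_1: "0 \<le> t \<Longrightarrow> norm (T t) \<le> 1"
  using assms unfolding contractive_C0_semigroup_def by (blast, blast, metis blinfun_apply_blinfun_compose, blast, blast)

lemma C0_semigroup_norm_apply_le:
  assumes "contractive_C0_semigroup T" "0 \<le> t"
  shows "norm (T t x) \<le> norm x"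
  using norm_blinfun[of "T t" x]
    mult_right_mono[OF C0_semigroup_norm_le_1[OF assms] norm_ge_zero, of x] by simp

lemma C0_semigroup_commute:
  assumes "contractive_C0_semigroup T" "0 \<le> s" "0 \<le> t"
  shows "T s (T t x) = T t (T s x)"
  by (metis assms add.commute C0_semigroup_add)

lemma C0_semigroup_isCont:
  assumes "contractive_C0_semigroup T" "0 < t"
  shows "isCont (\<lambda>t. T t x) t"
proof -
  have "continuous_on {0<..} (\<lambda>t. T t x)"
    by (rule continuous_on_subset[OF C0_semigroup_continuous_on[OF assms(1)]]) auto
  then show ?thesis
    using assms(2) by (simp add: continuous_on_eq_continuous_at)
qed

text \<open>
  The rescaled semigroup \<open>t \<mapsto> e\<^sup>-\<^sup>l\<^sup>t T(t)\<close>, with generator \<open>A - l\<close>. Facts about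
  orbits of contraction semigroups, applied to it, become facts about \<open>l - A\<close>.
\<close>

definition damped :: "complex \<Rightarrow> (real \<Rightarrow> 'a::complex_banach \<Rightarrow>\<^sub>L 'a) \<Rightarrow> real \<Rightarrow> 'a \<Rightarrow>\<^sub>L 'a" where
  "damped l T t = Blinfun (\<lambda>x. exp (- (l * of_real t)) *\<^sub>C T t x)"

lemma damped_apply:
  "damped l T t x = exp (- (l * of_real t)) *\<^sub>C T t x"
proof -
  have "bounded_linear (\<lambda>x. exp (- (l * of_real t)) *\<^sub>C T t x)"
    by (intro bounded_linear_compose[OF bounded_bilinear.bounded_linear_right[OF bounded_bilinear_scaleC]]
        blinfun.bounded_linear_right)
  then show ?thesis
    by (simp add: damped_def bounded_linear_Blinfun_apply)
qed

lemma norm_damped_apply: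
  "norm (damped l T t x) = exp (- (Re l * t)) * norm (T t x)"
  by (simp add: damped_apply norm_scaleC)

text \<open>
  The semigroup law holds because \<open>T s\<close>, being complex linear, commutes with the factor \<open>e\<^sup>-\<^sup>l\<^sup>t\<close>.
\<close>

lemma contractive_damped:
  assumes T: "contractive_C0_semigroup T" and l: "0 \<le> Re l"
  shows "contractive_C0_semigroup (damped l T)"
  unfolding contractive_C0_semigroup_def
proof (intro conjI allI impI)
  show "damped l T 0 = id_blinfun"
    by (rule blinfun_eqI) (simp add: damped_apply C0_semigroup_zero[OF T])
  fix t :: real assume t: "0 \<le> t"
  show "damped l T t (c *\<^sub>C x) = c *\<^sub>C damped l T t x" for c x
    by (simp add: damped_apply C0_semigroup_scaleC[OF T t] scaleC_scaleC mult.commute)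
  show "norm (damped l T t) \<le> 1"
  proof (rule norm_blinfun_bound)
    fix x
    have "norm (damped l T t x) \<le> 1 * norm (T t x)"
      unfolding norm_damped_apply using l t by (intro mult_right_mono) auto
    then show "norm (damped l T t x) \<le> 1 * norm x"
      using C0_semigroup_norm_apply_le[OF T t, of x] by simp
  qed simp
next
  fix s t :: real assume "0 \<le> s" "0 \<le> t"
  then show "damped l T (s + t) = damped l T s o\<^sub>L damped l T t"
    by (intro blinfun_eqI)
      (simp add: damped_apply C0_semigroup_add[OF T] C0_semigroup_scaleC[OF T] scaleC_scaleC
        exp_add[symmetric] algebra_simps)
next
  show "continuous_on {0..} (\<lambda>t. damped l T t x)" for x
    unfolding damped_apply
    by (intro continuous_on_scaleC C0_semigroup_continuous_on[OF T] continuous_intros)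
qed

section \<open>The generator\<close>

lemma generatorI_quotient:
  fixes T :: "real \<Rightarrow> 'a::complex_banach \<Rightarrow>\<^sub>L 'a"
  shows "((\<lambda>t. (1 / t) *\<^sub>R (T t x - x)) \<longlongrightarrow> y) (at_right 0) \<Longrightarrow> (x, y) \<in> generator T"
  by (simp add: generator_def)

lemma generatorD_quotient:
  fixes T :: "real \<Rightarrow> 'a::complex_banach \<Rightarrow>\<^sub>L 'a"
  shows "(x, y) \<in> generator T \<Longrightarrow> ((\<lambda>t. (1 / t) *\<^sub>R (T t x - x)) \<longlongrightarrow> y) (at_right 0)"
  by (simp add: generator_def)

lemma generator_add:
  assumes "(x, y) \<in> generator T" "(x', y') \<in> generator T"
  shows "(x + x', y + y') \<in> generator T"
  using tendsto_add[OF assms[THEN generatorD_quotient]]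
  by (intro generatorI_quotient) (simp add: blinfun.add_right algebra_simps)

lemma generator_scaleR:
  assumes "(x, y) \<in> generator T"
  shows "(r *\<^sub>R x, r *\<^sub>R y) \<in> generator T"
  using tendsto_scaleR[OF tendsto_const generatorD_quotient[OF assms], of r]
  by (intro generatorI_quotient) (simp add: blinfun.scaleR_right algebra_simps)

lemma generator_diff:
  assumes "(x, y) \<in> generator T" "(x', y') \<in> generator T"
  shows "(x - x', y - y') \<in> generator T"
  using generator_add[OF assms(1) generator_scaleR[OF assms(2), of "-1"]] by simp

lemma generator_semigroup:
  assumes T: "contractive_C0_semigroup T" and "0 \<le> s" and "(x, y) \<in> generator T"
  shows "(T s x, T s y) \<in> generator T"
proof (rule generatorI_quotient)
  have "((\<lambda>t. T s ((1 / t) *\<^sub>R (T t x - x))) \<longlongrightarrow> T s y) (at_right 0)"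
    by (intro blinfun.tendsto tendsto_const generatorD_quotient assms)
  moreover have "\<forall>\<^sub>F t in at_right 0. T s ((1 / t) *\<^sub>R (T t x - x)) = (1 / t) *\<^sub>R (T t (T s x) - T s x)"
    unfolding eventually_at_filter
    by (intro always_eventually)
      (simp add: blinfun.scaleR_right blinfun.diff_right C0_semigroup_commute[OF T \<open>0 \<le> s\<close>])
  ultimately show "((\<lambda>t. (1 / t) *\<^sub>R (T t (T s x) - T s x)) \<longlongrightarrow> T s y) (at_right 0)"
    by (rule Lim_transform_eventually)
qed

text \<open>
  The product rule at \<open>0\<close> for a scalar function and an orbit, in the one-sided form in which the
  generator is defined.
\<close>

lemma difference_quotient_scaleC:
  fixes c :: "real \<Rightarrow> complex" and u :: "real \<Rightarrow> 'a::complex_banach"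
  assumes c: "(c has_vector_derivative a) (at 0)" and c0: "c 0 = 1"
    and u: "((\<lambda>t. (1 / t) *\<^sub>R (u t - x)) \<longlongrightarrow> y) (at_right 0)"
  shows "((\<lambda>t. (1 / t) *\<^sub>R (c t *\<^sub>C u t - x)) \<longlongrightarrow> y + a *\<^sub>C x) (at_right 0)"
proof -
  have "((\<lambda>t. (c t - c 0) /\<^sub>R (t - 0)) \<longlongrightarrow> a) (at_right 0)"
    using has_vector_derivative_at_within[OF c, of "{0<..}"]
    by (simp only: has_vector_derivative_iff_quotient)
  then have "((\<lambda>t. ((1 / t) *\<^sub>R (c t - 1)) *\<^sub>C x) \<longlongrightarrow> a *\<^sub>C x) (at_right 0)"
    by (intro tendsto_scaleC tendsto_const) (simp add: c0 divide_inverse)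
  moreover have "(c \<longlongrightarrow> 1) (at_right 0)"
    using has_vector_derivative_continuous[OF has_vector_derivative_at_within[OF c, of "{0<..}"]]
    by (simp add: continuous_within c0)
  then have "((\<lambda>t. c t *\<^sub>C ((1 / t) *\<^sub>R (u t - x))) \<longlongrightarrow> 1 *\<^sub>C y) (at_right 0)"
    by (intro tendsto_scaleC u)
  ultimately have "((\<lambda>t. c t *\<^sub>C ((1 / t) *\<^sub>R (u t - x)) + ((1 / t) *\<^sub>R (c t - 1)) *\<^sub>C x)
      \<longlongrightarrow> y + a *\<^sub>C x) (at_right 0)"
    by (intro tendsto_add) simp_all
  then show ?thesis
    by (simp add: scaleC_scaleR_left scaleC_scaleR_right scaleC_diff_left scaleC_diff_right
        flip: scaleR_add_right)
qed

lemma generator_damped_iff: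
  "(x, y) \<in> generator (damped l T) \<longleftrightarrow> (x, y + l *\<^sub>C x) \<in> generator T"
proof
  have exp': "((\<lambda>t. exp (c * of_real t)) has_vector_derivative c) (at 0)" for c :: complex
    by (auto intro!: derivative_eq_intros has_vector_derivative_real_field
        simp flip: has_field_derivative_iff)
  \<comment> \<open>Multiplication by \<open>e\<^sup>l\<^sup>t\<close> undoes the damping, so that both directions are product rules.\<close>
  show "(x, y + l *\<^sub>C x) \<in> generator T" if "(x, y) \<in> generator (damped l T)"
  proof (rule generatorI_quotient)
    show "((\<lambda>t. (1 / t) *\<^sub>R (T t x - x)) \<longlongrightarrow> y + l *\<^sub>C x) (at_right 0)"
      using difference_quotient_scaleC[OF exp'[of l] _ generatorD_quotient[OF that]]
      by (simp add: damped_apply scaleC_scaleC flip: exp_add)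
  qed
  show "(x, y) \<in> generator (damped l T)" if "(x, y + l *\<^sub>C x) \<in> generator T"
  proof (rule generatorI_quotient)
    show "((\<lambda>t. (1 / t) *\<^sub>R (damped l T t x - x)) \<longlongrightarrow> y) (at_right 0)"
      using difference_quotient_scaleC[OF exp'[of "- l"] _ generatorD_quotient[OF that]]
      by (simp add: damped_apply scaleC_minus_left)
  qed
qed

text \<open>
  Since \<open>e\<^sup>-\<^sup>l\<^sup>t T(t)\<close> shrinks \<open>x\<close> by at least the factor \<open>e\<^sup>-\<^sup>t\<^sup>R\<^sup>e\<^sup>l\<close>, it moves \<open>x\<close> by at
  least \<open>(1 - e\<^sup>-\<^sup>t\<^sup>R\<^sup>e\<^sup>l) \<parallel>x\<parallel>\<close>; divide by \<open>t\<close> and let \<open>t\<close> tend to \<open>0\<close>. For \<open>Re l > 0\<close>, the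
  estimate makes \<open>l - A\<close> injective and bounds its inverse by \<open>1 / Re l\<close>.
\<close>

lemma generator_dissipative:
  assumes T: "contractive_C0_semigroup T" and "(x, y) \<in> generator T"
  shows "Re l * norm x \<le> norm (l *\<^sub>C x - y)"
proof -
  have "(x, y - l *\<^sub>C x) \<in> generator (damped l T)"
    using assms(2) by (simp add: generator_damped_iff)
  from tendsto_norm[OF generatorD_quotient[OF this]]
  have lim: "((\<lambda>t. norm ((1 / t) *\<^sub>R (damped l T t x - x))) \<longlongrightarrow> norm (l *\<^sub>C x - y)) (at_right 0)"
    by (simp only: norm_minus_commute)
  have "((\<lambda>t. exp (- (Re l * t))) has_vector_derivative - Re l) (at 0 within {0<..})"
    by (auto intro!: derivative_eq_intros simp flip: has_real_derivative_iff_has_vector_derivative)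
  then have "((\<lambda>t. - ((exp (- (Re l * t)) - 1) / t) * norm x) \<longlongrightarrow> - (- Re l) * norm x) (at_right 0)"
    unfolding has_vector_derivative_iff_quotient
    by (intro tendsto_intros) (simp add: divide_inverse mult.commute)
  moreover have "\<forall>\<^sub>F t in at_right 0.
      - ((exp (- (Re l * t)) - 1) / t) * norm x \<le> norm ((1 / t) *\<^sub>R (damped l T t x - x))"
    unfolding eventually_at_filter
  proof (intro always_eventually allI impI)
    fix t :: real assume "t \<in> {0<..}"
    then have t: "0 < t" by simp
    have "exp (- (Re l * t)) * norm (T t x) \<le> exp (- (Re l * t)) * norm x"
      using C0_semigroup_norm_apply_le[OF T, of t x] t by (intro mult_left_mono) auto
    then have "(1 - exp (- (Re l * t))) * norm x \<le> norm x - norm (damped l T t x)"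
      by (simp add: norm_damped_apply algebra_simps)
    also have "\<dots> \<le> norm (damped l T t x - x)"
      by (metis norm_minus_commute norm_triangle_ineq2)
    finally have "(1 - exp (- (Re l * t))) * norm x / t \<le> norm (damped l T t x - x) / t"
      using t by (intro divide_right_mono) auto
    moreover have "- ((exp (- (Re l * t)) - 1) / t) * norm x = (1 - exp (- (Re l * t))) * norm x / t"
      using t by (simp add: field_simps)
    ultimately show "- ((exp (- (Re l * t)) - 1) / t) * norm x \<le> norm ((1 / t) *\<^sub>R (damped l T t x - x))"
      using t by (simp only: norm_scaleR) simp
  qed
  ultimately show ?thesis
    using tendsto_le[OF _ lim] by simp
qed

text \<open>
  The generator only provides a derivative from the right at \<open>0\<close>. To obtain a two-sided one at
  \<open>s0\<close>, pull the semigroup up to the smaller of the two times out of the difference quotient: what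
  remains is a quotient at \<open>0\<close> with positive step \<open>\<bar>s - s0\<bar>\<close>.
\<close>

lemma orbit_has_vector_derivative:
  assumes T: "contractive_C0_semigroup T" and xy: "(x, y) \<in> generator T" and "0 < s0"
  shows "((\<lambda>s. T s x) has_vector_derivative T s0 y) (at s0)"
  unfolding has_vector_derivative_iff_quotient
proof -
  define m where "m s = min s s0" for s
  define q where "q h = (1 / h) *\<^sub>R (T h x - x)" for h
  have q: "((\<lambda>s. q \<bar>s - s0\<bar>) \<longlongrightarrow> y) (at s0)"
  proof (rule filterlim_compose[OF generatorD_quotient[OF xy, folded q_def]])
    show "filterlim (\<lambda>s. \<bar>s - s0\<bar>) (at_right 0) (at s0)"
      unfolding filterlim_at
      by (auto simp: eventually_at_filter intro!: tendsto_eq_intros always_eventually)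
  qed
  have m: "((\<lambda>s. T (m s) y) \<longlongrightarrow> T s0 y) (at s0)"
  proof (rule isCont_tendsto_compose[OF C0_semigroup_isCont[OF T \<open>0 < s0\<close>]])
    show "(m \<longlongrightarrow> s0) (at s0)"
      unfolding m_def by (auto intro!: tendsto_eq_intros)
  qed
  have pos: "\<forall>\<^sub>F s in at s0. 0 < s"
    using \<open>0 < s0\<close> by (intro order_tendstoD(1)[OF tendsto_ident_at])
  have "\<forall>\<^sub>F s in at s0. norm (T (m s)) \<le> 1"
    using pos by eventually_elim (use \<open>0 < s0\<close> in \<open>auto simp: m_def intro: C0_semigroup_norm_le_1[OF T]\<close>)
  from tendsto_blinfun_apply_strong[OF q m this]
  have "((\<lambda>s. T (m s) (q \<bar>s - s0\<bar>)) \<longlongrightarrow> T s0 y) (at s0)" .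
  moreover have "\<forall>\<^sub>F s in at s0. T (m s) (q \<bar>s - s0\<bar>) = (T s x - T s0 x) /\<^sub>R (s - s0)"
    using pos
  proof eventually_elim
    case (elim s)
    have split: "T a (T (b - a) x) = T b x" if "0 < a" "a \<le> b" for a b
      using C0_semigroup_add[OF T, of a "b - a" x] that by simp
    show ?case
    proof (cases "s \<le> s0")
      case True
      have "inverse (s - s0) = - (1 / (s0 - s))"
        by (simp add: divide_inverse flip: inverse_minus_eq)
      then show ?thesis
        using split[of s s0] elim True
        by (simp add: m_def q_def blinfun.scaleR_right blinfun.diff_right scaleR_diff_right)
    next
      case False
      then show ?thesis
        using split[of s0 s] \<open>0 < s0\<close>
        by (simp add: m_def q_def blinfun.scaleR_right blinfun.diff_right divide_inverse)
    qed
  qed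
  ultimately show "((\<lambda>s. (T s x - T s0 x) /\<^sub>R (s - s0)) \<longlongrightarrow> T s0 y) (at s0)"
    by (rule Lim_transform_eventually)
qed

text \<open>
  Applying \<open>T h\<close> shifts the interval of integration by \<open>h\<close>, so \<open>(T h - 1) \<integral>\<^sub>0\<^sup>s\<close> equals
  \<open>\<integral>\<^sub>s\<^sup>s\<^sup>+\<^sup>h - \<integral>\<^sub>0\<^sup>h\<close>, and division by \<open>h\<close> gives the derivatives of the primitive at \<open>s\<close> and at
  \<open>0\<close>.
\<close>

lemma integral_orbit_in_generator:
  assumes T: "contractive_C0_semigroup T" and s: "0 \<le> s"
  shows "(integral {0..s} (\<lambda>u. T u z), T s z - z) \<in> generator T"
proof (rule generatorI_quotient)
  define I where "I r = integral {0..r} (\<lambda>u. T u z)" for r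
  have cont: "continuous_on {a..b} (\<lambda>u. T u z)" if "0 \<le> a" for a b
    by (rule continuous_on_subset[OF C0_semigroup_continuous_on[OF T]]) (use that in auto)
  have int: "(\<lambda>u. T u z) integrable_on {a..b}" if "0 \<le> a" for a b
    by (rule integrable_continuous_interval[OF cont[OF that]])
  have quot: "((\<lambda>h. (1 / h) *\<^sub>R (I (r + h) - I r)) \<longlongrightarrow> T r z) (at_right 0)" if "0 \<le> r" for r
  proof -
    have "(I has_vector_derivative T r z) (at r within {0..r + 1})"
      unfolding I_def using that by (intro integral_has_vector_derivative cont) auto
    then have "((\<lambda>y. (I y - I r) /\<^sub>R (y - r)) \<longlongrightarrow> T r z) (at r within {r..r+1})"
      unfolding has_vector_derivative_iff_quotient[symmetric]
      by (rule has_vector_derivative_within_subset) (use that in auto)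
    then have "((\<lambda>y. (I y - I r) /\<^sub>R (y - r)) \<longlongrightarrow> T r z) (at_right r)"
      by (simp add: at_within_Icc_at_right)
    then show ?thesis
      unfolding at_right_to_0[of r] filterlim_filtermap by (simp add: add.commute divide_inverse)
  qed
  have "((\<lambda>h. (1 / h) *\<^sub>R (I (s + h) - I s) - (1 / h) *\<^sub>R (I (0 + h) - I 0)) \<longlongrightarrow> T s z - T 0 z) (at_right 0)"
    by (intro tendsto_diff quot s order_refl)
  moreover have "\<forall>\<^sub>F h in at_right 0. (1 / h) *\<^sub>R (I (s + h) - I s) - (1 / h) *\<^sub>R (I (0 + h) - I 0)
      = (1 / h) *\<^sub>R (T h (I s) - I s)"
    unfolding eventually_at_filter
  proof (intro always_eventually allI impI)
    fix h :: real assume "h \<in> {0<..}"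
    then have h: "0 < h" by simp
    have "T h (I s) = integral {0..s} (\<lambda>u. T h (T u z))"
      unfolding I_def
      by (rule integral_linear[OF int blinfun.bounded_linear_right, unfolded o_def, symmetric]) simp
    also have "\<dots> = integral {0..s} ((\<lambda>u. T u z) \<circ> (+) h)"
      by (rule integral_cong) (use h in \<open>simp add: C0_semigroup_add[OF T]\<close>)
    also have "\<dots> = integral {h..s + h} (\<lambda>u. T u z)"
      by (simp add: integral_shift_Icc_real)
    finally have "I h + T h (I s) = I (s + h)"
      unfolding I_def using Henstock_Kurzweil_Integration.integral_combine[OF _ _ int, of 0 h "s + h"] h s by simp
    then have "T h (I s) = I (s + h) - I h"
      by (simp add: algebra_simps)
    moreover have "I 0 = 0"
      by (simp add: I_def)
    ultimately show "(1 / h) *\<^sub>R (I (s + h) - I s) - (1 / h) *\<^sub>R (I (0 + h) - I 0)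
        = (1 / h) *\<^sub>R (T h (I s) - I s)"
      by (simp add: scaleR_diff_right)
  qed
  ultimately have "((\<lambda>h. (1 / h) *\<^sub>R (T h (I s) - I s)) \<longlongrightarrow> T s z - T 0 z) (at_right 0)"
    by (rule Lim_transform_eventually)
  then show "((\<lambda>h. (1 / h) *\<^sub>R (T h (integral {0..s} (\<lambda>u. T u z)) - integral {0..s} (\<lambda>u. T u z)))
      \<longlongrightarrow> T s z - z) (at_right 0)"
    by (simp add: I_def C0_semigroup_zero[OF T])
qed

text \<open>
  The averages \<open>(1 / h) \<integral>\<^sub>0\<^sup>h T(u) z du\<close> lie in the domain and tend to \<open>z\<close>.
\<close>

lemma generator_domain_dense:
  assumes T: "contractive_C0_semigroup T"
  shows "z \<in> closure (fst ` generator T)"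
proof -
  define I where "I r = integral {0..r} (\<lambda>u. T u z)" for r
  have "(I has_vector_derivative T 0 z) (at 0 within {0..1})"
    unfolding I_def
    by (intro integral_has_vector_derivative continuous_on_subset[OF C0_semigroup_continuous_on[OF T]]) auto
  then have "((\<lambda>h. (I h - I 0) /\<^sub>R (h - 0)) \<longlongrightarrow> T 0 z) (at_right 0)"
    by (simp add: has_vector_derivative_iff_quotient at_within_Icc_at_right)
  then have lim: "((\<lambda>h. (1 / h) *\<^sub>R I h) \<longlongrightarrow> z) (at_right 0)"
    by (simp add: I_def C0_semigroup_zero[OF T] divide_inverse)
  have "(1 / h) *\<^sub>R I h \<in> fst ` generator T" if "0 \<le> h" for h
    using generator_scaleR[OF integral_orbit_in_generator[OF T that, of z], of "1 / h"]
    unfolding I_def by force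
  then show ?thesis
    by (intro Lim_in_closed_set[OF closed_closure _ trivial_limit_at_right_real lim])
      (auto simp: eventually_at_filter intro!: always_eventually closure_subset[THEN subsetD])
qed

section \<open>Resolvent and cogenerator as bounded operators\<close>

lemma blinfun_of_graph_eq:
  assumes "G = {(x, blinfun_apply B x) | x. True}"
  shows "blinfun_of_graph G = B"
  unfolding blinfun_of_graph_def
proof (rule the_equality[where a = B])
  fix B' assume "G = {(x, blinfun_apply B' x) | x. True}"
  then have "(x, B' x) \<in> {(x, B x) | x. True}" for x
    using assms by blast
  then show "B' = B"
    by (intro blinfun_eqI) auto
qed (rule assms)

text \<open>
  With the damped semigroup \<open>S\<close>, the integral of \<open>S u z'\<close> over \<open>[0, 1]\<close> is mapped to
  \<open>z' - S 1 z'\<close> by \<open>l - A\<close>. As \<open>S 1\<close> is a strict contraction, every \<open>z\<close> has the form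
  \<open>z' - S 1 z'\<close>: solve for the fixed point of \<open>a \<mapsto> z + S 1 a\<close>.
\<close>

lemma resolvent_equation_solvable:
  assumes T: "contractive_C0_semigroup T" and l: "0 < Re l"
  shows "\<exists>x. (x, l *\<^sub>C x - z) \<in> generator T"
proof -
  define S where "S = damped l T"
  have S: "contractive_C0_semigroup S"
    unfolding S_def using l by (intro contractive_damped T) simp
  have "\<exists>!z'. z + S 1 z' = z'"
  proof (rule banach_fix_type)
    show "exp (- Re l) < 1" using l by simp
    show "\<forall>a b. dist (z + S 1 a) (z + S 1 b) \<le> exp (- Re l) * dist a b"
    proof (intro allI)
      fix a b
      have "dist (z + S 1 a) (z + S 1 b) = norm (S 1 (a - b))"
        by (simp add: dist_norm blinfun.diff_right)
      also have "\<dots> = exp (- Re l) * norm (T 1 (a - b))"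
        by (simp add: S_def norm_damped_apply)
      also have "\<dots> \<le> exp (- Re l) * dist a b"
        by (simp add: dist_norm C0_semigroup_norm_apply_le[OF T])
      finally show "dist (z + S 1 a) (z + S 1 b) \<le> exp (- Re l) * dist a b" .
    qed
  qed simp
  then obtain z' where z': "z + S 1 z' = z'"
    by blast
  define x where "x = integral {0..1} (\<lambda>u. S u z')"
  have "(x, S 1 z' - z') \<in> generator S"
    unfolding x_def by (rule integral_orbit_in_generator[OF S]) simp
  then have "(x, S 1 z' - z' + l *\<^sub>C x) \<in> generator T"
    by (simp add: S_def generator_damped_iff)
  moreover have "S 1 z' - z' = - z"
    using z' by (simp add: algebra_simps)
  ultimately show ?thesis
    by auto
qed

lemma resolvent_equation_unique:
  assumes T: "contractive_C0_semigroup T" and l: "0 < Re l"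
    and "(x, l *\<^sub>C x - z) \<in> generator T" "(x', l *\<^sub>C x' - z) \<in> generator T"
  shows "x = x'"
proof -
  have "(x - x', l *\<^sub>C (x - x')) \<in> generator T"
    using generator_diff[OF assms(3,4)] by (simp add: scaleC_diff_right)
  from generator_dissipative[OF T this, of l] show ?thesis
    using l by (simp add: mult_le_0_iff)
qed

lemma resolvent_graph:
  assumes T: "contractive_C0_semigroup T" and l: "0 < Re l"
  shows "{(l *\<^sub>C x - y, x) | x y. (x, y) \<in> generator T} = {(z, resolvent l (generator T) z) | z. True}"
    and "norm (resolvent l (generator T)) \<le> 1 / Re l"
proof -
  define f where "f z = (THE x. (x, l *\<^sub>C x - z) \<in> generator T)" for z
  have ex1: "\<exists>!x. (x, l *\<^sub>C x - z) \<in> generator T" for z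
    using resolvent_equation_solvable[OF T l] resolvent_equation_unique[OF T l] by blast
  have f: "(f z, l *\<^sub>C f z - z) \<in> generator T" for z
    unfolding f_def by (rule theI'[OF ex1])
  have f_eq: "f z = x" if "(x, l *\<^sub>C x - z) \<in> generator T" for x z
    using resolvent_equation_unique[OF T l f that] .
  have bound: "norm (f z) \<le> norm z * (1 / Re l)" for z
    using generator_dissipative[OF T f, of l z] l by (simp add: field_simps)
  have "bounded_linear f"
  proof (rule bounded_linear_intro[OF _ _ bound])
    show "f (z + z') = f z + f z'" for z z'
      using generator_add[OF f[of z] f[of z']]
      by (intro f_eq) (simp add: scaleC_add_right algebra_simps)
    show "f (r *\<^sub>R z) = r *\<^sub>R f z" for r z
      using generator_scaleR[OF f[of z], of r]
      by (intro f_eq) (simp add: scaleC_scaleR_right algebra_simps)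
  qed
  then have B: "blinfun_apply (Blinfun f) = f"
    by (rule bounded_linear_Blinfun_apply)
  have graph: "{(l *\<^sub>C x - y, x) | x y. (x, y) \<in> generator T} = {(z, Blinfun f z) | z. True}"
  proof (intro equalityI subsetI)
    fix p assume "p \<in> {(l *\<^sub>C x - y, x) | x y. (x, y) \<in> generator T}"
    then obtain x y where p: "p = (l *\<^sub>C x - y, x)" "(x, y) \<in> generator T"
      by blast
    then have "f (l *\<^sub>C x - y) = x"
      by (intro f_eq) simp
    then show "p \<in> {(z, Blinfun f z) | z. True}"
      using p(1) by (simp add: B)
  next
    fix p assume "p \<in> {(z, Blinfun f z) | z. True}"
    then obtain z where p: "p = (z, f z)"
      by (auto simp: B)
    then have "p = (l *\<^sub>C f z - (l *\<^sub>C f z - z), f z)"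
      by simp
    then show "p \<in> {(l *\<^sub>C x - y, x) | x y. (x, y) \<in> generator T}"
      using f by blast
  qed
  then have R: "resolvent l (generator T) = Blinfun f"
    unfolding resolvent_def by (rule blinfun_of_graph_eq)
  show "{(l *\<^sub>C x - y, x) | x y. (x, y) \<in> generator T} = {(z, resolvent l (generator T) z) | z. True}"
    using graph R by simp
  show "norm (resolvent l (generator T)) \<le> 1 / Re l"
    unfolding R by (rule norm_blinfun_bound) (use l bound in \<open>auto simp: B mult.commute\<close>)
qed

lemma norm_resolvent_apply_le:
  assumes "contractive_C0_semigroup T" "0 < Re l"
  shows "norm (resolvent l (generator T) z) \<le> norm z / Re l"
  using norm_blinfun[of "resolvent l (generator T)" z]
    mult_right_mono[OF resolvent_graph(2)[OF assms] norm_ge_zero, of z] by simp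

lemma resolvent_in_generator:
  assumes "contractive_C0_semigroup T" "0 < Re l"
  shows "(resolvent l (generator T) z, l *\<^sub>C resolvent l (generator T) z - z) \<in> generator T"
proof -
  have "(z, resolvent l (generator T) z) \<in> {(l *\<^sub>C x - y, x) | x y. (x, y) \<in> generator T}"
    unfolding resolvent_graph(1)[OF assms] by blast
  then obtain y where "z = l *\<^sub>C resolvent l (generator T) z - y"
      "(resolvent l (generator T) z, y) \<in> generator T"
    by auto
  then show ?thesis
    by (metis diff_diff_eq2 add_diff_cancel_left')
qed

lemma resolvent_eqI:
  assumes "contractive_C0_semigroup T" "0 < Re l" "(x, y) \<in> generator T"
  shows "resolvent l (generator T) (l *\<^sub>C x - y) = x"
proof -
  have "(l *\<^sub>C x - y, x) \<in> {(z, resolvent l (generator T) z) | z. True}"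
    unfolding resolvent_graph(1)[OF assms(1,2), symmetric] using assms(3) by blast
  then show ?thesis
    by auto
qed

lemma resolvent_semigroup_commute:
  assumes T: "contractive_C0_semigroup T" and l: "0 < Re l" and t: "0 \<le> t"
  shows "resolvent l (generator T) (T t z) = T t (resolvent l (generator T) z)"
  using resolvent_eqI[OF T l generator_semigroup[OF T t resolvent_in_generator[OF T l]], of z]
  by (simp add: blinfun.diff_right C0_semigroup_scaleC[OF T t])

text \<open>
  For \<open>(x, y)\<close> in the generator and \<open>u = y - x\<close> one has \<open>R(1) u = - x\<close>, hence
  \<open>y + x = u + 2 x = u - 2 R(1) u\<close>.
\<close>

lemma cogenerator_eq:
  assumes T: "contractive_C0_semigroup T"
  shows "cogenerator T = id_blinfun - 2 *\<^sub>R resolvent 1 (generator T)"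
  unfolding cogenerator_def
proof (rule blinfun_of_graph_eq, intro equalityI subsetI)
  let ?R = "resolvent 1 (generator T)"
  fix p assume "p \<in> {(y - x, y + x) | x y. (x, y) \<in> generator T}"
  then obtain x y where p: "p = (y - x, y + x)" and xy: "(x, y) \<in> generator T"
    by blast
  have "?R (y - x) = - x"
    using resolvent_eqI[OF T _ xy, of 1] blinfun.minus_right[of ?R "x - y"] by simp
  then have "(id_blinfun - 2 *\<^sub>R ?R) (y - x) = y - x + 2 *\<^sub>R x"
    by (simp add: blinfun.diff_left blinfun.scaleR_left)
  then have "p = (y - x, (id_blinfun - 2 *\<^sub>R ?R) (y - x))"
    unfolding p by (simp add: scaleR_2)
  then show "p \<in> {(z, (id_blinfun - 2 *\<^sub>R ?R) z) | z. True}"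
    by blast
next
  let ?R = "resolvent 1 (generator T)"
  fix p assume "p \<in> {(z, (id_blinfun - 2 *\<^sub>R ?R) z) | z. True}"
  then obtain z where p: "p = (z, z - 2 *\<^sub>R ?R z)"
    by (auto simp: blinfun.diff_left blinfun.scaleR_left)
  have "(- ?R z, z - ?R z) \<in> generator T"
    using generator_scaleR[OF resolvent_in_generator[OF T, of 1 z], of "- 1"] by simp
  moreover have "p = ((z - ?R z) - (- ?R z), (z - ?R z) + (- ?R z))"
    unfolding p by (simp add: scaleR_2)
  ultimately show "p \<in> {(y - x, y + x) | x y. (x, y) \<in> generator T}"
    by blast
qed

text \<open>
  The Laplace integral for the resolvent, stopped at time \<open>s\<close>, with an explicit remainder. The
  finite time matters: the semigroups are only assumed to be close on compact time intervals, and
  the remainder is of size \<open>e\<^sup>-\<^sup>s\<^sup>R\<^sup>e\<^sup>l\<close>.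
\<close>

lemma resolvent_laplace:
  assumes T: "contractive_C0_semigroup T" and l: "0 < Re l" and s: "0 \<le> s"
  shows "resolvent l (generator T) z
    = integral {0..s} (\<lambda>u. damped l T u z) + resolvent l (generator T) (damped l T s z)"
proof -
  let ?I = "integral {0..s} (\<lambda>u. damped l T u z)"
  have "contractive_C0_semigroup (damped l T)"
    using l by (intro contractive_damped T) simp
  from integral_orbit_in_generator[OF this s, of z]
  have "(?I, damped l T s z - z + l *\<^sub>C ?I) \<in> generator T"
    by (simp add: generator_damped_iff)
  from resolvent_eqI[OF T l this]
  have "resolvent l (generator T) (z - damped l T s z) = ?I"
    by simp
  then show ?thesis
    by (simp add: blinfun.diff_right algebra_simps)
qed

lemma norm_resolvent_diff_le:
  assumes T: "contractive_C0_semigroup T" and T': "contractive_C0_semigroup T'"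
    and d: "0 < d" "d \<le> Re l" and s: "0 \<le> s"
    and close: "\<And>u. 0 \<le> u \<Longrightarrow> u \<le> s \<Longrightarrow> norm (T u z - T' u z) \<le> e"
  shows "norm (resolvent l (generator T) z - resolvent l (generator T') z)
    \<le> e * s + 2 * (exp (- (d * s)) * norm z / d)"
proof -
  have l: "0 < Re l" "0 \<le> Re l" using d by auto
  have tail: "norm (resolvent l (generator U) (damped l U s z)) \<le> exp (- (d * s)) * norm z / d"
    if U: "contractive_C0_semigroup U" for U
  proof -
    have "norm (resolvent l (generator U) (damped l U s z)) \<le> norm (damped l U s z) / Re l"
      by (rule norm_resolvent_apply_le[OF U l(1)])
    also have "norm (damped l U s z) \<le> exp (- (d * s)) * norm z"
      unfolding norm_damped_apply
      using d s C0_semigroup_norm_apply_le[OF U s] by (intro mult_mono) (auto intro: mult_right_mono)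
    then have "norm (damped l U s z) / Re l \<le> exp (- (d * s)) * norm z / d"
      using d by (intro frac_le) auto
    finally show ?thesis .
  qed
  have cont: "continuous_on {0..s} (\<lambda>u. damped l U u z)" if "contractive_C0_semigroup U" for U
    by (rule continuous_on_subset[OF C0_semigroup_continuous_on[OF contractive_damped[OF that l(2)]]]) auto
  have "norm (integral {0..s} (\<lambda>u. damped l T u z - damped l T' u z)) \<le> e * (s - 0)"
  proof (rule integral_bound[OF s])
    show "continuous_on {0..s} (\<lambda>u. damped l T u z - damped l T' u z)"
      by (intro continuous_intros cont T T')
    fix u assume u: "u \<in> {0..s}"
    have "norm (damped l T u z - damped l T' u z) = exp (- (Re l * u)) * norm (T u z - T' u z)"
      by (simp add: damped_apply norm_scaleC flip: scaleC_diff_right)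
    also have "\<dots> \<le> 1 * e"
      using u l close by (intro mult_mono) auto
    finally show "norm (damped l T u z - damped l T' u z) \<le> e" by simp
  qed
  then have head: "norm (integral {0..s} (\<lambda>u. damped l T u z) - integral {0..s} (\<lambda>u. damped l T' u z)) \<le> e * s"
    by (subst integral_diff[symmetric]) (auto intro!: integrable_continuous_interval cont T T')
  let ?a = "integral {0..s} (\<lambda>u. damped l T u z)" and ?b = "resolvent l (generator T) (damped l T s z)"
  let ?a' = "integral {0..s} (\<lambda>u. damped l T' u z)" and ?b' = "resolvent l (generator T') (damped l T' s z)"
  have "norm ((?a + ?b) - (?a' + ?b')) \<le> norm (?a - ?a') + (norm ?b + norm ?b')"
    unfolding add_diff_add by (intro norm_triangle_mono norm_triangle_ineq4 order_refl)
  with head tail[OF T] tail[OF T'] show ?thesis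
    unfolding resolvent_laplace[OF T l(1) s, of z] resolvent_laplace[OF T' l(1) s, of z] by linarith
qed

text \<open>
  On a compact set of parameters, the real parts have a positive lower bound \<open>d\<close>. Choose the time
  \<open>s\<close> such that the remainders of the truncated Laplace integrals are small for this \<open>d\<close>, and then
  use that the semigroups are close up to time \<open>s\<close>.
\<close>

lemma uniform_limit_resolvent:
  assumes T0: "contractive_C0_semigroup T0"
    and T: "\<forall>\<^sub>F w in F. contractive_C0_semigroup (T w)"
    and lim: "\<And>s. uniform_limit {0..s} (\<lambda>w t. T w t z) (\<lambda>t. T0 t z) F"
    and L: "compact L" "L \<subseteq> {l. 0 < Re l}"
  shows "uniform_limit L (\<lambda>w l. resolvent l (generator (T w)) z) (\<lambda>l. resolvent l (generator T0) z) F"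
proof (cases "L = {}")
  case False
  obtain l0 where "l0 \<in> L" "\<And>l. l \<in> L \<Longrightarrow> Re l0 \<le> Re l"
    using continuous_attains_inf[OF L(1) False continuous_on_Re[OF continuous_on_id]] by auto
  define d where "d = Re l0"
  have d: "0 < d" "\<And>l. l \<in> L \<Longrightarrow> d \<le> Re l"
    using L(2) \<open>l0 \<in> L\<close> \<open>\<And>l. l \<in> L \<Longrightarrow> Re l0 \<le> Re l\<close> by (auto simp: d_def)
  show ?thesis
    unfolding uniform_limit_iff
  proof (intro allI impI)
    fix e :: real assume "0 < e"
    have "((\<lambda>s. 2 * (exp (- (d * s)) * norm z / d)) \<longlongrightarrow> 2 * (0 * norm z / d)) at_top"
    proof (intro tendsto_intros)
      have "LIM s at_top. - (d * s) :> at_bot"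
        unfolding filterlim_uminus_at_top[symmetric]
        by (rule filterlim_tendsto_pos_mult_at_top[OF tendsto_const d(1) filterlim_ident])
      then show "((\<lambda>s. exp (- (d * s))) \<longlongrightarrow> 0) at_top"
        by (rule filterlim_compose[OF exp_at_bot])
    qed (use d in auto)
    then have "\<forall>\<^sub>F s in at_top. 2 * (exp (- (d * s)) * norm z / d) < e / 2"
      by (rule order_tendstoD) (use \<open>0 < e\<close> in simp)
    then have "\<forall>\<^sub>F s in at_top. 0 < s \<and> 2 * (exp (- (d * s)) * norm z / d) < e / 2"
      by (intro eventually_conj eventually_gt_at_top)
    from eventually_happens[OF this] obtain s
      where s: "0 < s" "2 * (exp (- (d * s)) * norm z / d) < e / 2"
      by auto
    have "\<forall>\<^sub>F w in F. \<forall>t\<in>{0..s}. dist (T w t z) (T0 t z) < e / (2 * s)"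
      using uniform_limitD[OF lim] \<open>0 < e\<close> s(1) by simp
    with T show "\<forall>\<^sub>F w in F. \<forall>l\<in>L. dist (resolvent l (generator (T w)) z) (resolvent l (generator T0) z) < e"
    proof eventually_elim
      case (elim w)
      show ?case
      proof
        fix l assume "l \<in> L"
        have "norm (resolvent l (generator (T w)) z - resolvent l (generator T0) z)
            \<le> e / (2 * s) * s + 2 * (exp (- (d * s)) * norm z / d)"
          using elim(2) s(1)
          by (intro norm_resolvent_diff_le[OF elim(1) T0 d(1) d(2)[OF \<open>l \<in> L\<close>]])
            (auto simp: dist_norm less_imp_le)
        also have "\<dots> < e"
          using s by simp
        finally show "dist (resolvent l (generator (T w)) z) (resolvent l (generator T0) z) < e"
          by (simp add: dist_norm)
      qed
    qed
  qed
qed simp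

section \<open>From the resolvent at 1 to the semigroup\<close>

lemma resolvent_one_in_generator:
  assumes "contractive_C0_semigroup T"
  shows "(resolvent 1 (generator T) z, resolvent 1 (generator T) z - z) \<in> generator T"
  using resolvent_in_generator[OF assms, of 1 z] by simp

lemma norm_resolvent_one_le:
  assumes "contractive_C0_semigroup T"
  shows "norm (resolvent 1 (generator T)) \<le> 1"
  using resolvent_graph(2)[OF assms, of 1] by simp

lemma resolvent_one_dense_range:
  assumes T: "contractive_C0_semigroup T"
  shows "z \<in> closure (range (resolvent 1 (generator T)))"
proof -
  have "x \<in> range (resolvent 1 (generator T))" if "(x, y) \<in> generator T" for x y
    using resolvent_eqI[OF T _ that, of 1] rangeI[of "resolvent 1 (generator T)" "x - y"] by simp
  then have "fst ` generator T \<subseteq> range (resolvent 1 (generator T))"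
    by auto
  then show ?thesis
    using generator_domain_dense[OF T] closure_mono by blast
qed

text \<open>
  Duhamel's formula, as an inequality. The function \<open>g s = T1 (t - s) (R1 (T0 s (R0 x)))\<close> runs from
  \<open>R1 T1(t) R0 x\<close> to \<open>R1 T0(t) R0 x\<close>. Formally its derivative is \<open>T1(t - s) (R1 A0 - A1 R1) R0\<close>
  applied to \<open>T0(s) x\<close>, and \<open>A1 R1 = R1 - 1\<close> and \<open>A0 R0 = R0 - 1\<close> turn this into
  \<open>T1(t - s) (R0 - R1) T0(s) x\<close>. The resolvents on both sides of the difference of the semigroups
  thus make \<open>g\<close> differentiable and remove the unbounded generators from the derivative.
\<close>

lemma duhamel_bound:
  fixes T0 T1 :: "real \<Rightarrow> 'a::complex_banach \<Rightarrow>\<^sub>L 'a"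
  defines "R0 \<equiv> resolvent 1 (generator T0)" and "R1 \<equiv> resolvent 1 (generator T1)"
  assumes T0: "contractive_C0_semigroup T0" and T1: "contractive_C0_semigroup T1"
    and t: "0 \<le> t"
    and close: "\<And>s. 0 \<le> s \<Longrightarrow> s \<le> t \<Longrightarrow> norm (R1 (T0 s x) - R0 (T0 s x)) \<le> e"
  shows "norm (R1 (T0 t (R0 x)) - R1 (T1 t (R0 x))) \<le> e * t"
proof (cases "t = 0")
  case False
  then have "0 < t" using t by simp
  define v where "v s = R1 (T0 s (R0 x))" for s
  define g where "g s = T1 (t - s) (v s)" for s
  have R_T0: "R0 (T0 s y) = T0 s (R0 y)" and R_T1: "R1 (T1 s y) = T1 s (R1 y)" if "0 \<le> s" for s y
    unfolding R0_def R1_def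
    using resolvent_semigroup_commute[OF T0, of 1] resolvent_semigroup_commute[OF T1, of 1] that by auto
  have v_cont: "continuous_on {0..t} v"
    unfolding v_def
    by (intro blinfun.continuous_on continuous_on_const
        continuous_on_subset[OF C0_semigroup_continuous_on[OF T0]]) auto
  have T1_cont: "continuous_on {0..t} (\<lambda>s. T1 (t - s) y)" for y
    by (rule continuous_on_compose2[OF C0_semigroup_continuous_on[OF T1]]) (auto intro!: continuous_intros)
  have "norm (g t - g 0) \<le> (\<lambda>s. e * s) t - (\<lambda>s. e * s) 0"
  proof (rule differentiable_bound_general[OF \<open>0 < t\<close>])
    show "continuous_on {0..t} g"
      unfolding continuous_on
    proof
      fix s0 assume s0: "s0 \<in> {0..t}"
      have "(v \<longlongrightarrow> v s0) (at s0 within {0..t})"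
        using v_cont s0 by (simp add: continuous_on)
      moreover have "((\<lambda>s. T1 (t - s) (v s0)) \<longlongrightarrow> T1 (t - s0) (v s0)) (at s0 within {0..t})"
        using T1_cont[of "v s0"] s0 by (simp add: continuous_on)
      moreover have "\<forall>\<^sub>F s in at s0 within {0..t}. norm (T1 (t - s)) \<le> 1"
        unfolding eventually_at_filter
        by (intro always_eventually) (auto intro: C0_semigroup_norm_le_1[OF T1])
      ultimately show "(g \<longlongrightarrow> g s0) (at s0 within {0..t})"
        unfolding g_def by (rule tendsto_blinfun_apply_strong)
    qed
    show "((\<lambda>s. e * s) has_vector_derivative e) (at s)" for s
      by (auto intro!: derivative_eq_intros simp flip: has_real_derivative_iff_has_vector_derivative)
    show "continuous_on {0..t} (\<lambda>s. e * s)"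
      by (intro continuous_intros)
    fix s assume s: "0 < s" "s < t"
    \<comment> \<open>Product rule: first vary the outer semigroup with \<open>v s\<close> kept, then vary \<open>v\<close>.\<close>
    let ?q = "T0 s (R0 x)"
    have "((\<lambda>r. T1 r (R1 ?q)) has_vector_derivative T1 (t - s) (R1 ?q - ?q)) (at (t - s))"
      using s unfolding R1_def
      by (intro orbit_has_vector_derivative[OF T1] resolvent_one_in_generator[OF T1]) simp
    moreover have "((\<lambda>s. t - s) has_vector_derivative - 1) (at s)"
      by (auto intro!: derivative_eq_intros)
    ultimately have U': "((\<lambda>r. T1 (t - r) (v s)) has_vector_derivative - T1 (t - s) (R1 ?q - ?q)) (at s)"
      using vector_diff_chain_at[of "\<lambda>s. t - s" "- 1" s "\<lambda>r. T1 r (R1 ?q)" "T1 (t - s) (R1 ?q - ?q)"]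
      by (simp add: o_def v_def)
    have "((\<lambda>s. T0 s (R0 x)) has_vector_derivative T0 s (R0 x - x)) (at s)"
      unfolding R0_def
      by (intro orbit_has_vector_derivative[OF T0] resolvent_one_in_generator[OF T0] s)
    then have v': "(v has_vector_derivative R1 (T0 s (R0 x - x))) (at s)"
      unfolding v_def by (rule bounded_linear.has_vector_derivative[OF blinfun.bounded_linear_right])
    have U: "((\<lambda>r. T1 (t - r) y) \<longlongrightarrow> T1 (t - s) y) (at s)" for y
    proof (rule isCont_tendsto_compose[OF C0_semigroup_isCont[OF T1]])
      show "0 < t - s" using s by simp
    qed (intro tendsto_intros)
    have bound: "\<forall>\<^sub>F r in at s. norm (T1 (t - r)) \<le> 1"
      using order_tendstoD(2)[OF tendsto_ident_at s(2), of UNIV]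
      by eventually_elim (auto intro: C0_semigroup_norm_le_1[OF T1])
    have "(g has_vector_derivative
        - T1 (t - s) (R1 ?q - ?q) + T1 (t - s) (R1 (T0 s (R0 x - x)))) (at s)"
      unfolding g_def by (rule has_vector_derivative_blinfun_apply_strong[OF U' v' U bound])
    moreover have "- T1 (t - s) (R1 ?q - ?q) + T1 (t - s) (R1 (T0 s (R0 x - x)))
        = T1 (t - s) (R0 (T0 s x) - R1 (T0 s x))"
      using s by (simp add: R_T0 blinfun.diff_right)
    ultimately show "(g has_vector_derivative T1 (t - s) (R0 (T0 s x) - R1 (T0 s x))) (at s)"
      by simp
    show "norm (T1 (t - s) (R0 (T0 s x) - R1 (T0 s x))) \<le> e"
      using C0_semigroup_norm_apply_le[OF T1, of "t - s" "R0 (T0 s x) - R1 (T0 s x)"] close[of s] s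
      by (simp add: norm_minus_commute)
  qed
  then show ?thesis
    using t by (simp add: g_def v_def C0_semigroup_zero[OF T0] C0_semigroup_zero[OF T1] R_T1)
qed (simp add: C0_semigroup_zero[OF T0] C0_semigroup_zero[OF T1])

text \<open>
  The Trotter-Kato theorem for an arbitrary filter. Duhamel's inequality bounds
  \<open>R\<^sub>w (T0 - T\<^sub>w) R0 x\<close> by \<open>r\<close> times the distance of the resolvents on the orbit of \<open>x\<close> up to time \<open>r\<close>; the
  orbit is compact, so the distance tends to \<open>0\<close>. It remains to remove the two resolvents. The
  right one goes by density of its range. The left one is moved to the right side by the identity
  \<open>(T0 - T\<^sub>w) R0 y = (R0 - R\<^sub>w) T0 y + R\<^sub>w (T0 - T\<^sub>w) y + T\<^sub>w (R\<^sub>w - R0) y\<close>, where it disappears by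
  density once more.
\<close>

lemma trotter_kato:
  fixes T :: "'w \<Rightarrow> real \<Rightarrow> 'a::complex_banach \<Rightarrow>\<^sub>L 'a"
  assumes T0: "contractive_C0_semigroup T0"
    and T: "\<forall>\<^sub>F w in F. contractive_C0_semigroup (T w)"
    and lim: "\<And>x. ((\<lambda>w. resolvent 1 (generator (T w)) x) \<longlongrightarrow> resolvent 1 (generator T0) x) F"
  shows "uniform_limit {0..r} (\<lambda>w t. T w t z) (\<lambda>t. T0 t z) F"
proof (cases "0 \<le> r")
  case True
  define R0 where "R0 = resolvent 1 (generator T0)"
  define R where "R w = resolvent 1 (generator (T w))" for w
  have R_bound: "\<forall>\<^sub>F w in F. norm (R w) \<le> 1"
    using T by eventually_elim (simp add: R_def norm_resolvent_one_le)
  have R_diff_bound: "\<forall>\<^sub>F w in F. norm (R w - R0) \<le> 2"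
    using R_bound
  proof eventually_elim
    case (elim w)
    then show ?case
      using norm_triangle_ineq4[of "R w" R0] norm_resolvent_one_le[OF T0] by (simp add: R0_def)
  qed
  have T_diff_bound: "\<forall>\<^sub>F w in F. \<forall>t\<in>{0..r}. norm (T0 t - T w t) \<le> 2"
    using T
  proof eventually_elim
    case (elim w)
    show ?case
    proof
      fix t assume "t \<in> {0..r}"
      then show "norm (T0 t - T w t) \<le> 2"
        using norm_triangle_ineq4[of "T0 t" "T w t"] C0_semigroup_norm_le_1[OF T0, of t]
          C0_semigroup_norm_le_1[OF elim, of t] by simp
    qed
  qed
  have RT_diff_bound: "\<forall>\<^sub>F w in F. \<forall>t\<in>{0..r}. norm (R w o\<^sub>L (T0 t - T w t)) \<le> 2"
    using R_bound T_diff_bound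
  proof eventually_elim
    case (elim w)
    show ?case
    proof
      fix t assume "t \<in> {0..r}"
      then have "norm (R w) * norm (T0 t - T w t) \<le> 1 * 2"
        using elim by (intro mult_mono) auto
      then show "norm (R w o\<^sub>L (T0 t - T w t)) \<le> 2"
        using norm_blinfun_compose[of "R w" "T0 t - T w t"] by linarith
    qed
  qed
  have orbit: "uniform_limit {0..r} (\<lambda>w t. R w (T0 t x)) (\<lambda>t. R0 (T0 t x)) F" for x
  proof -
    have "compact ((\<lambda>t. T0 t x) ` {0..r})"
      by (intro compact_continuous_image compact_Icc
          continuous_on_subset[OF C0_semigroup_continuous_on[OF T0]]) auto
    then have "uniform_limit ((\<lambda>t. T0 t x) ` {0..r}) (\<lambda>w. blinfun_apply (R w)) (blinfun_apply R0) F"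
      by (rule uniform_limit_blinfun_compact[OF _ _ R_diff_bound]) (simp add: R_def R0_def lim)
    then show ?thesis
      by (rule uniform_limit_compose') auto
  qed
  have sandwiched_range: "uniform_limit {0..r} (\<lambda>w t. (R w o\<^sub>L (T0 t - T w t)) (R0 x)) (\<lambda>_. 0) F" for x
    unfolding uniform_limit_iff
  proof (intro allI impI)
    fix e :: real assume "0 < e"
    have "\<forall>\<^sub>F w in F. \<forall>t\<in>{0..r}. dist (R w (T0 t x)) (R0 (T0 t x)) < e / (r + 1)"
      using uniform_limitD[OF orbit] \<open>0 < e\<close> True by simp
    with T show "\<forall>\<^sub>F w in F. \<forall>t\<in>{0..r}. dist ((R w o\<^sub>L (T0 t - T w t)) (R0 x)) 0 < e"
    proof eventually_elim
      case (elim w)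
      show ?case
      proof
        fix t assume t: "t \<in> {0..r}"
        have "norm (R w (T0 t (R0 x)) - R w (T w t (R0 x))) \<le> e / (r + 1) * t"
          unfolding R0_def R_def
          by (rule duhamel_bound[OF T0 elim(1)])
            (use t elim(2) in \<open>auto simp: R0_def R_def dist_norm less_imp_le\<close>)
        also have "\<dots> \<le> e / (r + 1) * r"
          using t \<open>0 < e\<close> True by (intro mult_left_mono) auto
        also have "\<dots> < e"
          using \<open>0 < e\<close> True by (simp add: field_simps)
        finally show "dist ((R w o\<^sub>L (T0 t - T w t)) (R0 x)) 0 < e"
          by (simp add: blinfun.diff_left blinfun.diff_right)
      qed
    qed
  qed
  have sandwiched: "uniform_limit {0..r} (\<lambda>w t. (R w o\<^sub>L (T0 t - T w t)) y) (\<lambda>_. 0) F" for y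
    by (rule uniform_limit_zero_closure[OF RT_diff_bound _ resolvent_one_dense_range[OF T0, folded R0_def]])
      (elim rangeE, simp only: sandwiched_range)
  have diff_range: "uniform_limit {0..r} (\<lambda>w t. (T0 t - T w t) (R0 y)) (\<lambda>_. 0) F" for y
    unfolding uniform_limit_iff
  proof (intro allI impI)
    fix e :: real assume "0 < e"
    then have e: "0 < e / 3" by simp
    show "\<forall>\<^sub>F w in F. \<forall>t\<in>{0..r}. dist ((T0 t - T w t) (R0 y)) 0 < e"
      using T uniform_limitD[OF orbit e, of y] uniform_limitD[OF sandwiched e, of y]
        tendstoD[OF lim e, of y, folded R0_def R_def]
    proof eventually_elim
      case (elim w)
      show ?case
      proof
        fix t assume t: "t \<in> {0..r}"
        let ?a = "R0 (T0 t y) - R w (T0 t y)" and ?b = "(R w o\<^sub>L (T0 t - T w t)) y"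
          and ?c = "T w t (R w y - R0 y)"
        have "R0 (T0 t y) = T0 t (R0 y)" "R w (T w t y) = T w t (R w y)"
          unfolding R0_def R_def
          using resolvent_semigroup_commute[OF T0, of 1] resolvent_semigroup_commute[OF elim(1), of 1] t
          by auto
        then have "(T0 t - T w t) (R0 y) = ?a + ?b + ?c"
          by (simp add: blinfun.diff_left blinfun.diff_right)
        moreover have "norm ?a < e / 3"
          using elim(2) t by (simp add: dist_norm norm_minus_commute)
        moreover have "norm ?b < e / 3"
          using elim(3) t by simp
        moreover have "norm ?c < e / 3"
          using C0_semigroup_norm_apply_le[OF elim(1), of t "R w y - R0 y"] elim(4) t
          by (simp add: dist_norm)
        ultimately show "dist ((T0 t - T w t) (R0 y)) 0 < e"
          using norm_triangle_ineq[of "?a + ?b" ?c] norm_triangle_ineq[of ?a ?b] by simp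
      qed
    qed
  qed
  have "uniform_limit {0..r} (\<lambda>w t. (T0 t - T w t) z) (\<lambda>_. 0) F"
    by (rule uniform_limit_zero_closure[OF T_diff_bound _ resolvent_one_dense_range[OF T0, folded R0_def]])
      (elim rangeE, simp only: diff_range)
  then show ?thesis
    by (simp add: uniform_limit_iff dist_norm blinfun.diff_left norm_minus_commute)
qed simp

section \<open>The equivalence\<close>

lemma k_SOT_continuous_iff:
  "k_SOT_continuous X T \<longleftrightarrow>
    (\<forall>w0\<in>topspace X. \<forall>x r. uniform_limit {0..r} (\<lambda>w t. T w t x) (\<lambda>t. T w0 t x) (nhdsin X w0))"
proof -
  have "(\<forall>K. compact K \<and> K \<subseteq> {0..} \<longrightarrow> (\<forall>x. uniform_limit K (\<lambda>w t. T w t x) (\<lambda>t. T w0 t x) F)) \<longleftrightarrow>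
      (\<forall>x r. uniform_limit {0..r} (\<lambda>w t. T w t x) (\<lambda>t. T w0 t x) F)" (is "?L \<longleftrightarrow> ?R") for w0 F
  proof
    assume ?L
    then show ?R
      using compact_Icc by (metis atLeastatMost_subset_iff atLeastAtMost_iff atLeast_iff subsetI)
  next
    assume R: ?R
    show ?L
    proof (intro allI impI)
      fix K :: "real set" and x assume K: "compact K \<and> K \<subseteq> {0..}"
      then obtain r where "\<And>t. t \<in> K \<Longrightarrow> \<bar>t\<bar> \<le> r"
        using compact_imp_bounded bounded_iff by (metis real_norm_def)
      with K have "K \<subseteq> {0..r}"
        by force
      then show "uniform_limit K (\<lambda>w t. T w t x) (\<lambda>t. T w0 t x) F"
        using R uniform_limit_on_subset by blast
    qed
  qed
  then show ?thesis
    by (simp add: k_SOT_continuous_def blinfun.diff_left SUP_norm_diff_tendsto_0_iff_uniform_limit)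
qed

theorem theorem3p8:
  fixes X :: "'w topology"
    and T :: "'w \<Rightarrow> real \<Rightarrow> 'a::complex_banach \<Rightarrow>\<^sub>L 'a"
    and A :: "'w \<Rightarrow> ('a \<times> 'a) set"
    and V :: "'w \<Rightarrow> 'a \<Rightarrow>\<^sub>L 'a"
  assumes "compact_space X"
    and "\<And>w. w \<in> topspace X \<Longrightarrow> contractive_C0_semigroup (T w)"
    and "\<And>w. w \<in> topspace X \<Longrightarrow> A w = generator (T w)"
    and "\<And>w. w \<in> topspace X \<Longrightarrow> V w = cogenerator (T w)"
  shows "(k_SOT_continuous X T \<longleftrightarrow> resolvents_strongly_continuous_locally_uniformly X A)
    \<and> (resolvents_strongly_continuous_locally_uniformly X A \<longleftrightarrow>
         continuous_map X strong_operator_topology (\<lambda>w. resolvent 1 (A w)))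
    \<and> (continuous_map X strong_operator_topology (\<lambda>w. resolvent 1 (A w)) \<longleftrightarrow>
         continuous_map X strong_operator_topology V)"
proof -
  note T = assms(2) and A = assms(3) and V = assms(4)
  have in_space: "\<forall>\<^sub>F w in nhdsin X w0. w \<in> topspace X" if "w0 \<in> topspace X" for w0
    using that by (auto simp: eventually_nhdsin intro!: exI[of _ "topspace X"])
  have b_iff: "resolvents_strongly_continuous_locally_uniformly X A \<longleftrightarrow>
      (\<forall>w0\<in>topspace X. \<forall>L. compact L \<and> L \<subseteq> {z. 0 < Re z} \<longrightarrow>
        (\<forall>x. uniform_limit L (\<lambda>w l. resolvent l (A w) x) (\<lambda>l. resolvent l (A w0) x) (nhdsin X w0)))"
    by (simp add: resolvents_strongly_continuous_locally_uniformly_def blinfun.diff_left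
        SUP_norm_diff_tendsto_0_iff_uniform_limit)
  have a_b: "resolvents_strongly_continuous_locally_uniformly X A" if a: "k_SOT_continuous X T"
    unfolding b_iff
  proof (intro ballI allI impI)
    fix w0 L x assume w0: "w0 \<in> topspace X" and L: "compact L \<and> L \<subseteq> {z. 0 < Re z}"
    have "uniform_limit L (\<lambda>w l. resolvent l (generator (T w)) x)
        (\<lambda>l. resolvent l (generator (T w0)) x) (nhdsin X w0)"
    proof (rule uniform_limit_resolvent[OF T[OF w0]])
      show "\<forall>\<^sub>F w in nhdsin X w0. contractive_C0_semigroup (T w)"
        using in_space[OF w0] by eventually_elim (rule T)
    qed (use a w0 L in \<open>auto simp: k_SOT_continuous_iff\<close>)
    moreover have "\<forall>\<^sub>F w in nhdsin X w0. \<forall>l\<in>L. resolvent l (generator (T w)) x = resolvent l (A w) x"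
      using in_space[OF w0] by eventually_elim (simp add: A)
    ultimately show "uniform_limit L (\<lambda>w l. resolvent l (A w) x) (\<lambda>l. resolvent l (A w0) x) (nhdsin X w0)"
      by (simp add: A[OF w0] uniform_limit_cong)
  qed
  have b_c: "continuous_map X strong_operator_topology (\<lambda>w. resolvent 1 (A w))"
    if b: "resolvents_strongly_continuous_locally_uniformly X A"
    unfolding continuous_map_strong_iff_tendsto_nhdsin
  proof (intro ballI allI)
    fix w0 x assume "w0 \<in> topspace X"
    then show "((\<lambda>w. resolvent 1 (A w) x) \<longlongrightarrow> resolvent 1 (A w0) x) (nhdsin X w0)"
      using b[unfolded b_iff, rule_format, of w0 "{1}" x] by simp
  qed
  have c_a: "k_SOT_continuous X T"
    if c: "continuous_map X strong_operator_topology (\<lambda>w. resolvent 1 (A w))"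
    unfolding k_SOT_continuous_iff
  proof (intro ballI allI)
    fix w0 x r assume w0: "w0 \<in> topspace X"
    show "uniform_limit {0..r} (\<lambda>w t. T w t x) (\<lambda>t. T w0 t x) (nhdsin X w0)"
    proof (rule trotter_kato[OF T[OF w0]])
      show "\<forall>\<^sub>F w in nhdsin X w0. contractive_C0_semigroup (T w)"
        using in_space[OF w0] by eventually_elim (rule T)
      fix y
      have "((\<lambda>w. resolvent 1 (A w) y) \<longlongrightarrow> resolvent 1 (generator (T w0)) y) (nhdsin X w0)"
        using c w0 unfolding continuous_map_strong_iff_tendsto_nhdsin by (simp add: A)
      moreover have "\<forall>\<^sub>F w in nhdsin X w0. resolvent 1 (A w) y = resolvent 1 (generator (T w)) y"
        using in_space[OF w0] by eventually_elim (simp add: A)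
      ultimately show "((\<lambda>w. resolvent 1 (generator (T w)) y) \<longlongrightarrow> resolvent 1 (generator (T w0)) y) (nhdsin X w0)"
        by (rule Lim_transform_eventually)
    qed
  qed
  have V_apply: "V w x = x - 2 *\<^sub>R resolvent 1 (A w) x" if "w \<in> topspace X" for w x
    using that by (simp add: V A cogenerator_eq[OF T] blinfun.diff_left blinfun.scaleR_left)
  have c_d: "continuous_map X strong_operator_topology (\<lambda>w. resolvent 1 (A w)) \<longleftrightarrow>
      continuous_map X strong_operator_topology V"
    unfolding continuous_on_strong_operator_topo_iff_coordinatewise
  proof (intro iff_allI iffI)
    fix x
    assume "continuous_map X euclidean (\<lambda>w. resolvent 1 (A w) x)"
    then have "continuous_map X euclidean (\<lambda>w. x - 2 *\<^sub>R resolvent 1 (A w) x)"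
      unfolding continuous_map_euclidean_iff_tendsto_nhdsin
      by (auto intro!: tendsto_diff tendsto_scaleR tendsto_const)
    then show "continuous_map X euclidean (\<lambda>w. V w x)"
      by (rule continuous_map_eq) (simp add: V_apply)
  next
    fix x
    assume "continuous_map X euclidean (\<lambda>w. V w x)"
    then have "continuous_map X euclidean (\<lambda>w. (1 / 2) *\<^sub>R (x - V w x))"
      unfolding continuous_map_euclidean_iff_tendsto_nhdsin
      by (auto intro!: tendsto_diff tendsto_scaleR tendsto_const)
    then show "continuous_map X euclidean (\<lambda>w. resolvent 1 (A w) x)"
      by (rule continuous_map_eq) (simp add: V_apply)
  qed
  show ?thesis
    using a_b b_c c_a c_d by blast
qed

end
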